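(* Let $I$ be any non-degenerate interval of non-negative real numbers. Then for every large enough prime $q$ (in terms of $I$) there exists a positive rational $\alpha = \frac{p}{q} \in I$, with $p$ a positive integer, for which $\alpha \notin B(n)$ for all positive integers $n \le 0.3\, q \log^2 q$. In particular, $n_{\alpha} > 0.3\, q \log^2 q$.
   Context: For a positive rational $\alpha$ and a positive integer $n$, an $\alpha$-partition of $n$ is a finite set $\{a_1, \ldots, a_r\}$ of distinct positive integers with $a_1 + \cdots + a_r = n$ and $\frac{1}{a_1} + \cdots + \frac{1}{a_r} = \alpha$. $B(n)$ is the set of all positive rationals $\alpha$ for which an $\alpha$-partition of $n$ exists. The quantity $n_{\alpha}$ is the smallest positive integer such that for every integer $n \ge n_{\alpha}$ an $\alpha$-partition of $n$ exists (it is known, by a theorem of Graham, that $n_\alpha$ exists for every positive rational $\alpha$). Here $\log^2 q = (\log q)^2$ with $\log$ the natural logarithm. A non-degenerate interval is one containing more than one point. *)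

theory Defs
  imports "HOL-Analysis.Analysis" "HOL-Computational_Algebra.Primes"
begin

definition alpha_partition :: "rat \<Rightarrow> nat \<Rightarrow> nat set \<Rightarrow> bool" where
  "alpha_partition \<alpha> n A \<longleftrightarrow>
     finite A \<and> (\<forall>a\<in>A. 0 < a) \<and> \<Sum>A = n \<and> (\<Sum>a\<in>A. 1 / of_nat a) = \<alpha>"

definition B :: "nat \<Rightarrow> rat set" where
  "B n = {\<alpha>. 0 < \<alpha> \<and> (\<exists>A. alpha_partition \<alpha> n A)}"

definition threshold :: "rat \<Rightarrow> nat \<Rightarrow> bool" where
  "threshold \<alpha> N \<longleftrightarrow> 0 < N \<and> (\<forall>n\<ge>N. \<exists>A. alpha_partition \<alpha> n A)"

text \<open>
  The least threshold, taken in the extended naturals so that it is a total function without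
  presupposing Graham's theorem. The infimum of the empty set is \<open>\<infinity>\<close>; by Graham's theorem
  this does not occur for positive \<open>\<alpha>\<close>. The lemma below shows that the finite values are
  exactly the minima.
\<close>

definition n_alpha :: "rat \<Rightarrow> enat" where
  "n_alpha \<alpha> = (INF N\<in>{N. threshold \<alpha> N}. enat N)"

lemma n_alpha_eq_enat_iff:
  "n_alpha \<alpha> = enat N \<longleftrightarrow> threshold \<alpha> N \<and> (\<forall>M. threshold \<alpha> M \<longrightarrow> N \<le> M)"
proof
  assume eq: "n_alpha \<alpha> = enat N"
  have ne: "enat ` {N. threshold \<alpha> N} \<noteq> {}"
  proof
    assume "enat ` {N. threshold \<alpha> N} = {}"
    then have "n_alpha \<alpha> = \<infinity>"
      unfolding n_alpha_def by (simp add: Inf_enat_def)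
    with eq show False by simp
  qed
  then have "n_alpha \<alpha> \<in> enat ` {N. threshold \<alpha> N}"
    unfolding n_alpha_def Inf_enat_def using LeastI_ex[of "\<lambda>x. x \<in> enat ` {N. threshold \<alpha> N}"]
    by auto
  with eq have "threshold \<alpha> N" by auto
  moreover have "N \<le> M" if "threshold \<alpha> M" for M
  proof -
    have "n_alpha \<alpha> \<le> enat M"
      unfolding n_alpha_def using that by (intro INF_lower) simp
    with eq show ?thesis by simp
  qed
  ultimately show "threshold \<alpha> N \<and> (\<forall>M. threshold \<alpha> M \<longrightarrow> N \<le> M)" by blast
next
  assume "threshold \<alpha> N \<and> (\<forall>M. threshold \<alpha> M \<longrightarrow> N \<le> M)"
  then show "n_alpha \<alpha> = enat N"
    unfolding n_alpha_def by (intro antisym INF_lower INF_greatest) auto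
qed

end

theory Submission
  imports Defs "HOL-Real_Asymp.Real_Asymp"
begin

text \<open>
  If \<open>A\<close> is a \<open>p/q\<close>-partition of \<open>n\<close> with \<open>q\<close> prime, let \<open>S = {b. q b \<in> A}\<close>. The reciprocals of
  the members of \<open>A\<close> not divisible by \<open>q\<close> add up to a rational that is integral at \<open>q\<close>, so \<open>S\<close> alone
  determines \<open>p\<close> modulo \<open>q\<close>. Moreover \<open>n \<le> 0.3 q L\<^sup>2\<close> with \<open>L = ln q\<close> forces \<open>\<Sum>S \<le> 0.3 L\<^sup>2\<close>. By
  Rankin's trick there are at most \<open>exp (t m) (\<Prod>k. 1 + exp (- t k)) \<le> exp (t m + c / t)\<close> sets of
  positive integers with sum at most \<open>m\<close>, where \<open>c\<close> is any upper bound for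
  \<open>\<pi>\<^sup>2 / 12 = 1 - 1/4 + 1/9 - \<dots>\<close>. Seven terms of this series suffice: \<open>t = 5 / (3 L)\<close> then gives
  fewer than \<open>q powr 0.999\<close> residues, while linearly many (in \<open>q\<close>) residues \<open>p\<close> have \<open>p/q \<in> I\<close>.
\<close>

section \<open>Sets of positive integers with bounded sum\<close>

text \<open>
  These truncate the series of \<open>ln (1 + y)\<close> and of \<open>- Li\<^sub>2 (- y)\<close>, so \<open>- dilog_poly (exp (- t u)) / t\<close> is
  an antiderivative in \<open>u\<close> of \<open>ln_poly (exp (- t u))\<close>. Ending with a positive term makes
  \<open>ln_poly\<close> an upper bound.
\<close>

definition ln_poly :: "real \<Rightarrow> real" where
  "ln_poly y = y - y^2/2 + y^3/3 - y^4/4 + y^5/5 - y^6/6 + y^7/7"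

definition dilog_poly :: "real \<Rightarrow> real" where
  "dilog_poly y = y - y^2/4 + y^3/9 - y^4/16 + y^5/25 - y^6/36 + y^7/49"

text \<open>The two sides agree at 0, and the derivative of their difference is the remainder
  \<open>x^7 / (1 + x)\<close> of a finite geometric series.\<close>

lemma ln_one_plus_le_ln_poly:
  assumes "0 \<le> y"
  shows "ln (1 + y) \<le> ln_poly y"
proof -
  have "ln_poly 0 - ln (1 + 0) \<le> ln_poly y - ln (1 + y)"
  proof (rule DERIV_nonneg_imp_nondecreasing[OF assms])
    fix x :: real
    assume x: "0 \<le> x" "x \<le> y"
    have "((\<lambda>y. ln_poly y - ln (1 + y)) has_real_derivative
        (1 - x + x^2 - x^3 + x^4 - x^5 + x^6) - 1 / (1 + x)) (at x)"
      unfolding ln_poly_def using x by (auto intro!: derivative_eq_intros)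
    moreover have "(1 - x + x^2 - x^3 + x^4 - x^5 + x^6) - 1 / (1 + x) = x^7 / (1 + x)"
      using x by (simp add: field_simps eval_nat_numeral)
    ultimately show "\<exists>d. ((\<lambda>y. ln_poly y - ln (1 + y)) has_real_derivative d) (at x) \<and> 0 \<le> d"
      using x by auto
  qed
  then show ?thesis by (simp add: ln_poly_def)
qed

text \<open>Each negative term is dominated by the positive term before it. This lets the last term
  of a telescoping sum be dropped.\<close>

lemma dilog_poly_nonneg:
  assumes "0 \<le> y" "y \<le> 1"
  shows "0 \<le> dilog_poly y"
proof -
  have "y^Suc k \<le> y^k" "0 \<le> y^k" for k
    using assms by (simp_all add: mult_left_le_one_le)
  note pow = this
  have "y^2 \<le> y" "y^4 \<le> y^3" "y^6 \<le> y^5"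
    using pow(1)[of 1] pow(1)[of 3] pow(1)[of 5] by (simp_all add: power2_eq_square)
  with assms pow(2)[of 3] pow(2)[of 5] pow(2)[of 7] show ?thesis
    unfolding dilog_poly_def by linarith
qed

text \<open>Integral comparison on one unit interval: the left side decreases in its argument, so
  its value at the right endpoint is at most its value at the mean value point
  \<open>z\<close>.\<close>

lemma ln_one_plus_exp_le_diff:
  assumes "0 < t"
  shows "ln (1 + exp (- t * real (Suc k))) \<le>
    (dilog_poly (exp (- t * real k)) - dilog_poly (exp (- t * real (Suc k)))) / t"
proof -
  define F where "F u = - dilog_poly (exp (- t * u)) / t" for u
  have "(F has_real_derivative ln_poly (exp (- t * u))) (at u)" for u
  proof -
    define y where "y = exp (- t * u)"
    have "(dilog_poly has_real_derivative
        1 - y/2 + y^2/3 - y^3/4 + y^4/5 - y^5/6 + y^6/7) (at y)" (is "(_ has_real_derivative ?D) _")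
      unfolding dilog_poly_def by (auto intro!: derivative_eq_intros)
    moreover have "((\<lambda>u. exp (- t * u)) has_real_derivative y * (- t)) (at u)"
      unfolding y_def by (auto intro!: derivative_eq_intros)
    ultimately have "((\<lambda>u. dilog_poly (exp (- t * u))) has_real_derivative ?D * (y * (- t))) (at u)"
      unfolding y_def by (rule DERIV_chain2)
    then have "(F has_real_derivative - (?D * (y * (- t))) / t) (at u)"
      unfolding F_def by (intro DERIV_cdivide DERIV_minus)
    moreover have "- (?D * (y * (- t))) / t = ?D * y"
      using assms by simp
    moreover have "?D * y = ln_poly y"
      by (simp add: ln_poly_def algebra_simps eval_nat_numeral)
    ultimately show ?thesis by (simp add: y_def)
  qed
  from MVT2[of "real k" "real (Suc k)" F, OF _ this] obtain z
    where z: "real k < z" "z < real (Suc k)"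
      and eq: "F (real (Suc k)) - F (real k) = (real (Suc k) - real k) * ln_poly (exp (- t * z))"
    by auto
  have "ln (1 + exp (- t * real (Suc k))) \<le> ln (1 + exp (- t * z))"
    using z assms by (simp add: add_pos_pos)
  also have "\<dots> \<le> ln_poly (exp (- t * z))"
    by (intro ln_one_plus_le_ln_poly) simp
  also have "\<dots> = F (real (Suc k)) - F (real k)"
    using eq by simp
  finally show ?thesis
    by (simp add: F_def diff_divide_distrib)
qed

text \<open>After taking logarithms the bounds telescope, starting from \<open>exp 0 = 1\<close>;
  the result does not depend on \<open>M\<close>.\<close>

lemma prod_one_plus_exp_le:
  assumes "0 < t"
  shows "(\<Prod>k\<in>{1..M}. 1 + exp (- t * real k)) \<le> exp (dilog_poly 1 / t)"
proof -
  have pos: "0 < 1 + exp (- t * real k)" for k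
    by (simp add: add_pos_pos)
  have "(\<Prod>k\<in>{1..M}. 1 + exp (- t * real k)) = exp (\<Sum>k\<in>{1..M}. ln (1 + exp (- t * real k)))"
    using pos by (simp add: exp_sum)
  also have "(\<Sum>k\<in>{1..M}. ln (1 + exp (- t * real k))) =
      (\<Sum>k<M. ln (1 + exp (- t * real (Suc k))))"
    by (simp add: sum.atLeast1_atMost_eq del: of_nat_Suc)
  also have "\<dots> \<le> (\<Sum>k<M. dilog_poly (exp (- t * real k)) / t - dilog_poly (exp (- t * real (Suc k))) / t)"
    using ln_one_plus_exp_le_diff[OF assms] by (intro sum_mono) (simp add: diff_divide_distrib)
  also have "\<dots> = dilog_poly 1 / t - dilog_poly (exp (- t * real M)) / t"
    by (subst sum_lessThan_telescope') simp
  also have "\<dots> \<le> dilog_poly 1 / t"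
    using assms by (simp add: dilog_poly_nonneg)
  finally show ?thesis by simp
qed

section \<open>Rankin's bound for the number of such sets\<close>

definition bounded_sum_sets :: "real \<Rightarrow> nat set set" where
  "bounded_sum_sets m = {S. finite S \<and> 0 \<notin> S \<and> real (\<Sum>S) \<le> m}"

lemma bounded_sum_sets_subset: "bounded_sum_sets m \<subseteq> Pow {1..nat \<lfloor>m\<rfloor>}"
proof
  fix S
  assume S: "S \<in> bounded_sum_sets m"
  have "x \<in> {1..nat \<lfloor>m\<rfloor>}" if "x \<in> S" for x
  proof -
    have "x \<le> \<Sum>S"
      using S that by (auto simp: bounded_sum_sets_def intro: member_le_sum)
    then have "real x \<le> m"
      using S by (metis (mono_tags, lifting) bounded_sum_sets_def mem_Collect_eq of_nat_le_iff order_trans)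
    moreover have "x \<noteq> 0"
      using S that by (metis (mono_tags, lifting) bounded_sum_sets_def mem_Collect_eq)
    ultimately show ?thesis by (simp add: le_nat_floor)
  qed
  then show "S \<in> Pow {1..nat \<lfloor>m\<rfloor>}" by blast
qed

lemma finite_bounded_sum_sets: "finite (bounded_sum_sets m)"
  using bounded_sum_sets_subset by (rule finite_subset) simp

text \<open>Each set counted has weight \<open>exp (t * (m - real (\<Sum>S)))\<close> at least 1.
  Summed over all subsets of \<open>{1..M}\<close>, these weights factor into a product.\<close>

lemma card_bounded_sum_sets_le:
  assumes "0 < t"
  shows "real (card (bounded_sum_sets m)) \<le> exp (t * m + dilog_poly 1 / t)"
proof -
  define M where "M = nat \<lfloor>m\<rfloor>"
  have "real (card (bounded_sum_sets m)) = (\<Sum>S\<in>bounded_sum_sets m. 1)"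
    by simp
  also have "\<dots> \<le> (\<Sum>S\<in>bounded_sum_sets m. exp (t * (m - real (\<Sum>S))))"
    using assms by (intro sum_mono) (simp add: bounded_sum_sets_def)
  also have "\<dots> \<le> (\<Sum>S\<in>Pow {1..M}. exp (t * (m - real (\<Sum>S))))"
    using bounded_sum_sets_subset by (intro sum_mono2) (auto simp: M_def)
  also have "\<dots> = exp (t * m) * (\<Sum>S\<in>Pow {1..M}. \<Prod>k\<in>S. exp (- t * real k))"
    unfolding sum_distrib_left
  proof (intro sum.cong refl)
    fix S
    assume "S \<in> Pow {1..M}"
    then have "finite S" by (auto intro: finite_subset)
    then show "exp (t * (m - real (\<Sum>S))) = exp (t * m) * (\<Prod>k\<in>S. exp (- t * real k))"
      by (simp add: exp_sum[symmetric] exp_add[symmetric] sum_negf sum_distrib_left[symmetric]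
          right_diff_distrib)
  qed
  also have "\<dots> = exp (t * m) * (\<Prod>k\<in>{1..M}. 1 + exp (- t * real k))"
    by (simp add: prod_add add.commute[of 1])
  also have "\<dots> \<le> exp (t * m) * exp (dilog_poly 1 / t)"
    by (intro mult_left_mono prod_one_plus_exp_le assms) simp
  finally show ?thesis by (simp add: exp_add)
qed

lemma card_bounded_sum_sets_le_powr:
  assumes "1 < x"
  shows "real (card (bounded_sum_sets (0.3 * (ln x)\<^sup>2))) \<le> x powr 0.999"
proof -
  have L: "0 < ln x" using assms by simp
  \<comment> \<open>The choice \<open>t = 5 / (3 * ln x)\<close> nearly minimises the exponent. As
    \<open>dilog_poly 1\<close> is about 0.8312, the factor of \<open>ln x\<close> is about
    0.9987.\<close>
  have "5 / (3 * ln x) * (0.3 * (ln x)\<^sup>2) + dilog_poly 1 / (5 / (3 * ln x)) =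
      (1/2 + 3/5 * dilog_poly 1) * ln x"
    using L by (simp add: field_simps power2_eq_square)
  also have "\<dots> \<le> 0.999 * ln x"
    using L by (intro mult_right_mono) (simp_all add: dilog_poly_def)
  finally have "exp (5 / (3 * ln x) * (0.3 * (ln x)\<^sup>2) + dilog_poly 1 / (5 / (3 * ln x))) \<le>
      x powr 0.999"
    using assms by (simp add: powr_def)
  moreover have "0 < 5 / (3 * ln x)" using L by simp
  ultimately show ?thesis
    using card_bounded_sum_sets_le order_trans by blast
qed

section \<open>The multiples of \<open>q\<close> in a partition\<close>

text \<open>The product serves as a common denominator; it is prime to \<open>q\<close> as soon as
  no member of \<open>R\<close> is a multiple of \<open>q\<close>.\<close>

lemma sum_reciprocals_times_prod_Ints:
  assumes "finite R" "\<forall>a\<in>R. 0 < (a::nat)"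
  shows "(\<Sum>a\<in>R. 1 / of_nat a) * of_nat (\<Prod>R) \<in> (\<int> :: 'a::field_char_0 set)"
  unfolding sum_distrib_right
proof (intro Ints_sum)
  fix a
  assume "a \<in> R"
  with assms have "(1 / of_nat a) * of_nat (\<Prod>R) = (of_nat (\<Prod>(R - {a})) :: 'a)"
    by (simp add: prod.remove)
  then show "(1 / of_nat a) * of_nat (\<Prod>R) \<in> (\<int> :: 'a set)"
    by (metis Ints_of_nat)
qed

lemma multiples_image: "{a\<in>A. (q::nat) dvd a} = (*) q ` {b. q * b \<in> A}"
  by (fastforce simp: dvd_def)

text \<open>The shared multiples of \<open>q\<close> cancel in the difference of the two sums. What
  remains has a denominator prime to \<open>q\<close>, and multiplying by \<open>q\<close> gives
  \<open>p - p'\<close>.\<close>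

lemma multiples_determine_residue:
  fixes q :: nat and p p' :: int
  assumes q: "prime q"
    and A: "finite A" "\<forall>a\<in>A. 0 < a" "(\<Sum>a\<in>A. 1 / of_nat a) = (of_int p / of_nat q :: rat)"
    and A': "finite A'" "\<forall>a\<in>A'. 0 < a" "(\<Sum>a\<in>A'. 1 / of_nat a) = (of_int p' / of_nat q :: rat)"
    and eq: "{a\<in>A. q dvd a} = {a\<in>A'. q dvd a}"
  shows "int q dvd p - p'"
proof -
  define R where "R = {a\<in>A. \<not> q dvd a}"
  define R' where "R' = {a\<in>A'. \<not> q dvd a}"
  let ?s = "\<lambda>X. (\<Sum>a\<in>X. 1 / of_nat a) :: rat"
  have fin: "finite R" "finite R'" and pos: "\<forall>a\<in>R. 0 < a" "\<forall>a\<in>R'. 0 < a"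
    using A(1,2) A'(1,2) by (simp_all add: R_def R'_def)
  have "?s X = ?s {a\<in>X. q dvd a} + ?s {a\<in>X. \<not> q dvd a}" if "finite X" for X
  proof -
    have "?s X = ?s ({a\<in>X. q dvd a} \<union> {a\<in>X. \<not> q dvd a})"
      by (rule sum.cong) auto
    also have "\<dots> = ?s {a\<in>X. q dvd a} + ?s {a\<in>X. \<not> q dvd a}"
      using that by (intro sum.union_disjoint) auto
    finally show ?thesis .
  qed
  then have "?s A = ?s {a\<in>A. q dvd a} + ?s R" "?s A' = ?s {a\<in>A'. q dvd a} + ?s R'"
    using A(1) A'(1) by (simp_all only: R_def R'_def)
  with A A' eq have diff: "of_int (p - p') = of_nat q * (?s R - ?s R')"
    using prime_gt_0_nat[OF q] by (simp add: field_simps)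
  obtain u v where uv: "?s R * of_nat (\<Prod>R) = of_int u" "?s R' * of_nat (\<Prod>R') = of_int v"
    using sum_reciprocals_times_prod_Ints fin pos by (metis Ints_cases)
  have "(of_int ((p - p') * int (\<Prod>R * \<Prod>R')) :: rat) =
      of_int (p - p') * (of_nat (\<Prod>R) * of_nat (\<Prod>R'))"
    by (simp del: of_nat_prod)
  also have "\<dots> = of_nat q * (?s R * of_nat (\<Prod>R) * of_nat (\<Prod>R') - ?s R' * of_nat (\<Prod>R') * of_nat (\<Prod>R))"
    unfolding diff by (simp only: algebra_simps)
  also have "\<dots> = of_int (int q * (u * int (\<Prod>R') - v * int (\<Prod>R)))"
    unfolding uv by (simp del: of_nat_prod)
  finally have "int q dvd (p - p') * int (\<Prod>R * \<Prod>R')"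
    unfolding of_int_eq_iff by simp
  moreover have "\<not> q dvd \<Prod>R * \<Prod>R'"
    using q fin by (auto simp: prime_dvd_mult_iff prime_dvd_prod_iff R_def R'_def)
  ultimately show ?thesis
    using q by (metis int_dvd_int_iff prime_dvd_mult_iff prime_nat_int_transfer)
qed

text \<open>The multiples of \<open>q\<close> in \<open>A\<close> alone contribute \<open>q\<close>
  times the sum of their cofactors to \<open>n\<close>.\<close>

lemma cofactors_in_bounded_sum_sets:
  assumes "0 < q" "alpha_partition \<alpha> n A" "real n \<le> real q * m"
  shows "{b. q * b \<in> A} \<in> bounded_sum_sets m"
proof -
  have A: "finite A" "\<forall>a\<in>A. 0 < a" "\<Sum>A = n"
    using assms by (auto simp: alpha_partition_def)
  have inj: "inj_on ((*) q) X" for X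
    using assms by (auto simp: inj_on_def)
  have img: "(*) q ` {b. q * b \<in> A} \<subseteq> A" by auto
  then have "finite {b. q * b \<in> A}"
    using A inj finite_imageD finite_subset by metis
  moreover have "0 \<notin> {b. q * b \<in> A}"
    using A by force
  moreover have "q * \<Sum>{b. q * b \<in> A} = \<Sum>((*) q ` {b. q * b \<in> A})"
    using inj by (simp add: sum.reindex sum_distrib_left)
  then have "q * \<Sum>{b. q * b \<in> A} \<le> n"
    using sum_mono2[OF A(1) img, of "\<lambda>x. x"] A by simp
  then have "real q * real (\<Sum>{b. q * b \<in> A}) \<le> real q * m"
    using assms(3) by (metis of_nat_le_iff of_nat_mult order_trans)
  then have "real (\<Sum>{b. q * b \<in> A}) \<le> m"
    using assms(1) by simp
  ultimately show ?thesis by (simp add: bounded_sum_sets_def)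
qed

text \<open>Sending \<open>p\<close> to the cofactor set of a chosen partition is injective, since
  equal cofactor sets force congruent numerators.\<close>

lemma card_representable_le:
  fixes P :: "nat set"
  assumes q: "prime q"
    and P: "\<And>p p'. p \<in> P \<Longrightarrow> p' \<in> P \<Longrightarrow> int q dvd int p - int p' \<Longrightarrow> p = p'"
    and rep: "\<And>p. p \<in> P \<Longrightarrow>
      \<exists>n A. alpha_partition (of_nat p / of_nat q) n A \<and> real n \<le> real q * m"
  shows "card P \<le> card (bounded_sum_sets m)"
proof -
  obtain n A where nA: "\<And>p. p \<in> P \<Longrightarrow>
      alpha_partition (of_nat p / of_nat q) (n p) (A p) \<and> real (n p) \<le> real q * m"
    using rep by metis
  have q0: "0 < q" using q by (rule prime_gt_0_nat)
  define S where "S p = {b. q * b \<in> A p}" for p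
  have "inj_on S P"
  proof (rule inj_onI)
    fix p p'
    assume p: "p \<in> P" "p' \<in> P" and "S p = S p'"
    then have "{a \<in> A p. q dvd a} = {a \<in> A p'. q dvd a}"
      unfolding multiples_image S_def by simp
    with nA[OF p(1)] nA[OF p(2)] have "int q dvd int p - int p'"
      by (intro multiples_determine_residue[OF q, of "A p" _ "A p'"]) (auto simp: alpha_partition_def)
    with p show "p = p'" by (rule P)
  qed
  moreover have "S ` P \<subseteq> bounded_sum_sets m"
    unfolding S_def using cofactors_in_bounded_sum_sets[OF q0] nA by blast
  ultimately show ?thesis
    by (rule card_inj_on_le) (rule finite_bounded_sum_sets)
qed

text \<open>A finite least threshold \<open>N\<close> itself admits a partition, so it cannot lie in
  the excluded range.\<close>

lemma n_alpha_greater: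
  assumes "0 < \<alpha>" "\<And>n. 0 < n \<Longrightarrow> real n \<le> x \<Longrightarrow> \<alpha> \<notin> B n"
  shows "ereal x < ereal_of_enat (n_alpha \<alpha>)"
proof (cases "n_alpha \<alpha>")
  case (enat N)
  then have "threshold \<alpha> N" by (simp add: n_alpha_eq_enat_iff)
  then have "0 < N" "\<alpha> \<in> B N"
    using assms(1) by (auto simp: threshold_def B_def)
  with assms(2)[of N] have "x < real N" by (meson not_le)
  with enat show ?thesis by simp
qed simp

theorem theorem2:
  fixes I :: "real set"
  assumes "is_interval I"
    and "I \<subseteq> {0..}"
    and "\<exists>x\<in>I. \<exists>y\<in>I. x \<noteq> y"
  shows "\<exists>q0::nat. \<forall>q::nat. prime q \<and> q \<ge> q0 \<longrightarrow>
    (\<exists>(\<alpha>::rat) (p::nat). 0 < p \<and> \<alpha> = of_nat p / of_nat q \<and> real_of_rat \<alpha> \<in> I \<and>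
       (\<forall>n::nat. 0 < n \<and> real n \<le> 0.3 * real q * (ln (real q))\<^sup>2 \<longrightarrow> \<alpha> \<notin> B n) \<and>
       ereal_of_enat (n_alpha \<alpha>) > ereal (0.3 * real q * (ln (real q))\<^sup>2))"
proof -
  obtain a b' where "a \<in> I" "b' \<in> I" "a < b'"
    using assms(3) by (metis linorder_neqE_linordered_idom)
  \<comment> \<open>Capping the length at 1 keeps the numerators below distinct modulo
    \<open>q\<close>.\<close>
  define b where "b = min b' (a + 1)"
  have ab: "0 \<le> a" "a < b" "b \<le> a + 1"
    using \<open>a \<in> I\<close> \<open>a < b'\<close> assms(2) by (auto simp: b_def)
  have sub: "x \<in> I" if "a \<le> x" "x \<le> b" for x
    using mem_is_interval_1_I[OF assms(1) \<open>a \<in> I\<close> \<open>b' \<in> I\<close>] that by (simp add: b_def)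
  have "0 < b - a" using ab by simp
  \<comment> \<open>The count of cofactor sets is sublinear in \<open>q\<close>, the count of
    numerators linear; the 1 pays for rounding.\<close>
  then have "eventually (\<lambda>q::nat. real q powr 0.999 < (b - a) * real q - 1) at_top"
    by real_asymp
  then obtain q0 where q0: "\<And>q. q \<ge> q0 \<Longrightarrow> real q powr 0.999 < (b - a) * real q - 1"
    by (auto simp: eventually_at_top_linorder)
  show ?thesis
  proof (intro exI[of _ q0] allI impI)
    fix q :: nat
    assume "prime q \<and> q \<ge> q0"
    then have q: "prime q" and big: "real q powr 0.999 < (b - a) * real q - 1"
      using q0 by auto
    have q1: "1 < real q" using prime_gt_1_nat[OF q] by simp
    define m where "m = 0.3 * (ln (real q))\<^sup>2"
    \<comment> \<open>The open lower end makes every numerator positive, even when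
      \<open>a = 0\<close>.\<close>
    define P where "P = {nat \<lfloor>a * q\<rfloor> <.. nat \<lfloor>b * q\<rfloor>}"
    have P: "0 < p" "a * q < p" "p \<le> b * q" if "p \<in> P" for p
    proof -
      have "nat \<lfloor>a * q\<rfloor> < p" "p \<le> nat \<lfloor>b * q\<rfloor>" using that by (auto simp: P_def)
      moreover from this have "0 < p" by simp
      ultimately show "0 < p" "a * q < p" "p \<le> b * q"
        using ab by linarith+
    qed
    have "0 \<le> a * q" "0 \<le> b * q" using ab by simp_all
    then have "(b - a) * q - 1 < real (card P)"
      unfolding P_def card_greaterThanAtMost left_diff_distrib by linarith
    with big card_bounded_sum_sets_le_powr[OF q1] have less: "card (bounded_sum_sets m) < card P"
      unfolding m_def by linarith
    \<comment> \<open>Two members of \<open>P\<close> differ by less than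
      \<open>(b - a) * q\<close>, hence by less than \<open>q\<close>.\<close>
    have "p = p'" if "p \<in> P" "p' \<in> P" "int q dvd int p - int p'" for p p'
    proof (rule ccontr)
      assume "p \<noteq> p'"
      with that(3) have "int q \<le> \<bar>int p - int p'\<bar>"
        by (intro zdvd_imp_le) auto
      then have "real q \<le> \<bar>real p - real p'\<bar>" by linarith
      moreover have "\<bar>real p - real p'\<bar> < b * q - a * q"
        using P[OF that(1)] P[OF that(2)] by linarith
      moreover have "b * q \<le> (a + 1) * q"
        using ab by (intro mult_right_mono) auto
      ultimately show False by (simp add: distrib_right)
    qed
    \<comment> \<open>Pigeonhole: if every numerator in \<open>P\<close> had a small partition,
      \<open>P\<close> would have at most as many members as
      \<open>bounded_sum_sets m\<close>.\<close>
    with less card_representable_le[OF q, of P m] obtain p where p: "p \<in> P"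
      and none: "\<And>n A. real n \<le> real q * m \<Longrightarrow> \<not> alpha_partition (of_nat p / of_nat q) n A"
      by (metis not_le)
    define \<alpha> :: rat where "\<alpha> = of_nat p / of_nat q"
    have "real_of_rat \<alpha> = real p / real q"
      by (simp add: \<alpha>_def of_rat_divide)
    moreover have "a \<le> real p / real q" "real p / real q \<le> b"
      using P[OF p] q1 by (simp_all add: field_simps)
    ultimately have "real_of_rat \<alpha> \<in> I"
      using sub by simp
    moreover have notB: "\<alpha> \<notin> B n" if "real n \<le> 0.3 * real q * (ln (real q))\<^sup>2" for n
      using none[of n] that by (auto simp: B_def \<alpha>_def m_def mult_ac)
    moreover have "0 < \<alpha>" using P(1)[OF p] q1 by (simp add: \<alpha>_def)
    then have "ereal (0.3 * real q * (ln (real q))\<^sup>2) < ereal_of_enat (n_alpha \<alpha>)"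
      using notB by (intro n_alpha_greater)
    ultimately show "\<exists>(\<alpha>::rat) (p::nat). 0 < p \<and> \<alpha> = of_nat p / of_nat q \<and> real_of_rat \<alpha> \<in> I \<and>
       (\<forall>n::nat. 0 < n \<and> real n \<le> 0.3 * real q * (ln (real q))\<^sup>2 \<longrightarrow> \<alpha> \<notin> B n) \<and>
       ereal_of_enat (n_alpha \<alpha>) > ereal (0.3 * real q * (ln (real q))\<^sup>2)"
      using P(1)[OF p] \<alpha>_def by blast
  qed
qed

end
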